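(* Let $\mathcal{A}$ be a linear, homogeneous, constant-coefficient differential operator of order $k\in\mathbb{N}$ (acting on $X$-valued maps on $\mathbb{R}^d$) that has the constant rank property and has spanning wave cone. Let $F\in X$, let $\mathcal{K}=\{a_0,a_1\}\subset X$ with $a_0\ne a_1$, and set $a:=a_1-a_0$ and $a_\theta:=(1-\theta)a_0+\theta a_1$. Then there exists a unique minimizer $\theta\in[0,1]$ of $$\theta\mapsto |F-a_\theta|_{\mathcal{A}}^2+\theta(1-\theta)h_{\mathcal{A}}(a),\qquad \theta\in[0,1].$$
   Context: Setting: $d\in\mathbb{N}=\{1,2,\dots\}$, $X,Y$ are finite-dimensional real inner product spaces, and $\mathcal{A}:C^\infty(\mathbb{R}^d;X)\to C^\infty(\mathbb{R}^d;Y)$ has the form $\mathcal{A}=\sum_{|\alpha|=k}A_\alpha\partial^\alpha$ with $A_\alpha\in\mathrm{Lin}(X;Y)$. $|\cdot|_{\mathcal{A}}$ is the norm of $X$. The symbol is $\mathbb{A}(\xi)=\sum_{|\alpha|=k}\xi^\alpha A_\alpha$. Constant rank property: there is $r\in\mathbb{N}$ with $\operatorname{rank}\mathbb{A}(\xi)=r$ for all $\xi\in\mathbb{R}^d\setminus\{0\}$. For $\xi\in\mathbb{R}^d\setminus\{0\}$, $V_{\mathcal{A}}(\xi):=\ker\mathbb{A}(\xi)\subset X$ and $\mathbb{P}_{\mathcal{A}}(\xi)$ is the orthogonal projection of $X$ onto $V_{\mathcal{A}}(\xi)$. The wave cone is $\Lambda_{\mathcal{A}}:=\bigcup_{\xi\in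 S^{d-1}}V_{\mathcal{A}}(\xi)$; spanning wave cone means $\operatorname{span}\Lambda_{\mathcal{A}}=X$. For $a\in X$, $h_{\mathcal{A}}(a):=\inf_{\xi\in S^{d-1}}|a-\mathbb{P}_{\mathcal{A}}(\xi)a|_{\mathcal{A}}^2$. *)

theory Defs
  imports "HOL-Analysis.Analysis"
begin

definition partial :: "'d::finite \<Rightarrow> (real^'d \<Rightarrow> 'x::real_normed_vector) \<Rightarrow> real^'d \<Rightarrow> 'x" where
  "partial i u x = frechet_derivative u (at x) (axis i 1)"

primrec C_upto :: "nat \<Rightarrow> (real^'d::finite \<Rightarrow> 'x::real_normed_vector) \<Rightarrow> bool" where
  "C_upto 0 u \<longleftrightarrow> continuous_on UNIV u"
| "C_upto (Suc n) u \<longleftrightarrow> u differentiable_on UNIV \<and> (\<forall>i. C_upto n (partial i u))"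

definition C_infinity :: "(real^'d::finite \<Rightarrow> 'x::real_normed_vector) set" where
  "C_infinity = {u. \<forall>n. C_upto n u}"

type_synonym 'd multi_index = "'d \<Rightarrow> nat"

abbreviation multi_indices :: "nat \<Rightarrow> 'd::finite multi_index set" where
  "multi_indices k \<equiv> {\<alpha>. sum \<alpha> UNIV = k}"

lemma finite_multi_indices: "finite (multi_indices k :: 'd::finite multi_index set)"
proof (rule finite_subset)
  show "(multi_indices k :: 'd multi_index set) \<subseteq> (\<Pi>\<^sub>E i\<in>UNIV. {..k})"
    by (auto simp: PiE_def intro: member_le_sum)
  show "finite (\<Pi>\<^sub>E i\<in>(UNIV::'d set). {..k})"
    by (intro finite_PiE) auto
qed

(* The type of coordinates carries no order, so the order in which the partial derivatives
   are taken is chosen; on C_infinity the result does not depend on this choice (Schwarz). *)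
definition multi_partial ::
    "'d::finite multi_index \<Rightarrow> (real^'d \<Rightarrow> 'x::real_normed_vector) \<Rightarrow> real^'d \<Rightarrow> 'x" where
  "multi_partial \<alpha> = foldr partial (SOME is. \<forall>i. count_list is i = \<alpha> i)"

lemma exists_multi_index_list: "\<exists>is. \<forall>i. count_list is i = (\<alpha> :: 'd::finite multi_index) i"
proof -
  have "finite {i. 0 < \<alpha> i}" by simp
  then obtain M where "count M = \<alpha>" using Abs_multiset_inverse by blast
  moreover obtain xs where "mset xs = M" using ex_mset by blast
  ultimately show ?thesis by (metis count_mset)
qed

(* The operator sum_{|alpha| = k} A_alpha d^alpha. Since 'x and 'y are finite-dimensional,
   the bounded linear maps 'x => 'y are all the linear ones. Values of the operator at
   non-smooth maps, and A alpha for |alpha| different from k, are irrelevant. *)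
definition homogeneous_operator ::
    "nat \<Rightarrow> ('d::finite multi_index \<Rightarrow> 'x::euclidean_space \<Rightarrow>\<^sub>L 'y::euclidean_space) \<Rightarrow>
     ((real^'d \<Rightarrow> 'x) \<Rightarrow> (real^'d \<Rightarrow> 'y)) \<Rightarrow> bool" where
  "homogeneous_operator k A \<A> \<longleftrightarrow>
     (\<forall>u\<in>C_infinity. \<forall>x. \<A> u x = (\<Sum>\<alpha>\<in>multi_indices k. A \<alpha> (multi_partial \<alpha> u x)))"

definition symbol ::
    "nat \<Rightarrow> ('d::finite multi_index \<Rightarrow> 'x::euclidean_space \<Rightarrow>\<^sub>L 'y::euclidean_space) \<Rightarrow>
     real^'d \<Rightarrow> 'x \<Rightarrow>\<^sub>L 'y" where
  "symbol k A \<xi> = (\<Sum>\<alpha>\<in>multi_indices k. (\<Prod>i\<in>UNIV. (\<xi> $ i) ^ \<alpha> i) *\<^sub>R A \<alpha>)"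

(* The rank is taken in {1, 2, ...}. This forces Y to be nonzero, so it agrees with the class
   euclidean_space having only types of positive dimension. *)
definition constant_rank ::
    "nat \<Rightarrow> ('d::finite multi_index \<Rightarrow> 'x::euclidean_space \<Rightarrow>\<^sub>L 'y::euclidean_space) \<Rightarrow> bool" where
  "constant_rank k A \<longleftrightarrow> (\<exists>r\<ge>1. \<forall>\<xi>. \<xi> \<noteq> 0 \<longrightarrow> dim (range (symbol k A \<xi>)) = r)"

definition symbol_kernel ::
    "nat \<Rightarrow> ('d::finite multi_index \<Rightarrow> 'x::euclidean_space \<Rightarrow>\<^sub>L 'y::euclidean_space) \<Rightarrow>
     real^'d \<Rightarrow> 'x set" where
  "symbol_kernel k A \<xi> = {a. symbol k A \<xi> a = 0}"

definition orthogonal_projection :: "'x::euclidean_space set \<Rightarrow> 'x \<Rightarrow> 'x" where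
  "orthogonal_projection V a = (THE v. v \<in> V \<and> (\<forall>w\<in>V. orthogonal (a - v) w))"

lemma ex1_orthogonal_projection:
  assumes "subspace V"
  shows "\<exists>!v. v \<in> V \<and> (\<forall>w\<in>V. orthogonal (a - v) (w::'x::euclidean_space))"
proof (rule ex_ex1I)
  show "\<exists>v. v \<in> V \<and> (\<forall>w\<in>V. orthogonal (a - v) w)"
    using orthogonal_subspace_decomp_exists[of V a] assms
    by (metis add_diff_cancel_left' span_eq_iff)
next
  fix v v' assume v: "v \<in> V \<and> (\<forall>w\<in>V. orthogonal (a - v) w)"
    and v': "v' \<in> V \<and> (\<forall>w\<in>V. orthogonal (a - v') w)"
  have "v - v' \<in> V" using v v' assms by (simp add: subspace_diff)
  then have "orthogonal ((a - v') - (a - v)) (v - v')"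
    using v v' by (simp add: orthogonal_def inner_diff_left)
  then show "v = v'" by (simp add: orthogonal_self)
qed

definition wave_cone ::
    "nat \<Rightarrow> ('d::finite multi_index \<Rightarrow> 'x::euclidean_space \<Rightarrow>\<^sub>L 'y::euclidean_space) \<Rightarrow> 'x set" where
  "wave_cone k A = (\<Union>\<xi>\<in>sphere 0 1. symbol_kernel k A \<xi>)"

definition h_cone ::
    "nat \<Rightarrow> ('d::finite multi_index \<Rightarrow> 'x::euclidean_space \<Rightarrow>\<^sub>L 'y::euclidean_space) \<Rightarrow> 'x \<Rightarrow> real" where
  "h_cone k A a = (INF \<xi>\<in>sphere 0 1. (norm (a - orthogonal_projection (symbol_kernel k A \<xi>) a))\<^sup>2)"

end

theory Submission
  imports Defs
begin

text \<open>The function to be minimized is a quadratic polynomial in \<open>\<theta>\<close> whose leading coefficient is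
  \<open>|a|\<^sup>2 - h(a)\<close>. Since the wave cone spans and \<open>a \<noteq> 0\<close>, some kernel is not orthogonal to \<open>a\<close>;
  the projection onto it strictly shortens the distance, so that \<open>h(a) < |a|\<^sup>2\<close> and the quadratic
  is strictly convex.\<close>

text \<open>The projection \<open>p\<close> cannot vanish, since otherwise \<open>a\<close> itself
  would be orthogonal to \<open>v\<close>. Pythagoras for the splitting of \<open>a\<close> into
  \<open>a - p\<close> and \<open>p\<close> then gives strictness.\<close>

lemma norm_diff_orthogonal_projection_less:
  fixes V :: "'x::euclidean_space set"
  assumes V: "subspace V" and v: "v \<in> V" "a \<bullet> v \<noteq> 0"
  shows "norm (a - orthogonal_projection V a) < norm a"
proof -
  define p where "p = orthogonal_projection V a"
  have p: "p \<in> V" "\<And>w. w \<in> V \<Longrightarrow> orthogonal (a - p) w"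
    using theI'[OF ex1_orthogonal_projection[OF V, of a]]
    by (auto simp: p_def orthogonal_projection_def)
  have "p \<noteq> 0"
    using p(2)[OF v(1)] v(2) by (auto simp: orthogonal_def)
  moreover have "(norm a)\<^sup>2 = (norm (a - p))\<^sup>2 + (norm p)\<^sup>2"
    using norm_add_Pythagorean[OF p(2)[OF p(1)]] by simp
  ultimately have "(norm (a - p))\<^sup>2 < (norm a)\<^sup>2"
    by simp
  then show ?thesis
    unfolding p_def by (rule power_less_imp_less_base) simp
qed

lemma subspace_symbol_kernel: "subspace (symbol_kernel k A \<xi>)"
  by (simp add: symbol_kernel_def subspace_def blinfun.add_right blinfun.scaleR_right)

lemma h_cone_less:
  assumes "span (wave_cone k A) = UNIV" and "a \<noteq> 0"
  shows "h_cone k A a < (norm a)\<^sup>2"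
proof -
  \<comment> \<open>A vector orthogonal to the whole wave cone is orthogonal to its span, hence to
    itself.\<close>
  have "\<exists>v\<in>wave_cone k A. a \<bullet> v \<noteq> 0"
  proof (rule ccontr)
    assume "\<not> ?thesis"
    then have "orthogonal a a"
      by (intro orthogonal_to_span[of a "wave_cone k A"]) (auto simp: assms orthogonal_def)
    with assms(2) show False
      by (simp add: orthogonal_self)
  qed
  then obtain \<xi> v where \<xi>: "\<xi> \<in> sphere 0 1" and v: "v \<in> symbol_kernel k A \<xi>" "a \<bullet> v \<noteq> 0"
    by (auto simp: wave_cone_def)
  \<comment> \<open>The squared distances are bounded below by 0, so their infimum is at most the
    value at this one direction.\<close>
  have "h_cone k A a \<le> (norm (a - orthogonal_projection (symbol_kernel k A \<xi>) a))\<^sup>2"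
    unfolding h_cone_def using \<xi> by (intro cINF_lower bdd_belowI2[of _ 0]) auto
  also have "\<dots> < (norm a)\<^sup>2"
    using norm_diff_orthogonal_projection_less[OF subspace_symbol_kernel v]
    by (simp add: power_strict_mono)
  finally show ?thesis .
qed

text \<open>Existence follows from compactness of the interval. Two distinct minimizers are
  impossible because the value at their midpoint would be smaller still.\<close>

lemma ex1_is_arg_min_quadratic:
  fixes b c e l u :: real
  assumes "0 < c" and "l \<le> u"
  shows "\<exists>!t. is_arg_min (\<lambda>t. c * t\<^sup>2 + b * t + e) (\<lambda>t. t \<in> {l..u}) t"
proof -
  define f where "f t = c * t\<^sup>2 + b * t + e" for t
  have "\<exists>t\<in>{l..u}. \<forall>s\<in>{l..u}. f t \<le> f s"
    using assms(2) unfolding f_def by (intro continuous_attains_inf continuous_intros) auto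
  then have ex: "\<exists>t. is_arg_min f (\<lambda>t. t \<in> {l..u}) t"
    by (auto simp: is_arg_min_linorder)
  have "s = t" if s: "is_arg_min f (\<lambda>t. t \<in> {l..u}) s" and t: "is_arg_min f (\<lambda>t. t \<in> {l..u}) t" for s t
  proof (rule ccontr)
    assume "s \<noteq> t"
    have "(s + t) / 2 \<in> {l..u}"
      using s t by (auto simp: is_arg_min_linorder)
    then have "f s \<le> f ((s + t) / 2)" "f t \<le> f ((s + t) / 2)"
      using s t by (auto simp: is_arg_min_linorder)
    \<comment> \<open>Strict convexity in quantitative form: the affine part of \<open>f\<close>
      cancels, and the square leaves a gap that is positive for distinct points.\<close>
    moreover have "f ((s + t) / 2) = (f s + f t) / 2 - c * (s - t)\<^sup>2 / 4"
      by (simp add: f_def power2_eq_square field_simps)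
    moreover have "0 < c * (s - t)\<^sup>2"
      using assms(1) \<open>s \<noteq> t\<close> by simp
    ultimately show False
      by argo
  qed
  with ex show ?thesis
    unfolding f_def by blast
qed

theorem proposition1p10:
  fixes \<A> :: "(real^'d \<Rightarrow> 'x::euclidean_space) \<Rightarrow> (real^'d \<Rightarrow> 'y::euclidean_space)"
    and A :: "'d::finite multi_index \<Rightarrow> 'x \<Rightarrow>\<^sub>L 'y"
    and k :: nat
    and F a\<^sub>0 a\<^sub>1 :: 'x
  assumes "k \<ge> 1"
    and "homogeneous_operator k A \<A>"
    and "constant_rank k A"
    and "span (wave_cone k A) = UNIV"
    and "a\<^sub>0 \<noteq> a\<^sub>1"
  shows "\<exists>!\<theta>. is_arg_min
           (\<lambda>t::real. (norm (F - ((1 - t) *\<^sub>R a\<^sub>0 + t *\<^sub>R a\<^sub>1)))\<^sup>2 + t * (1 - t) * h_cone k A (a\<^sub>1 - a\<^sub>0))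
           (\<lambda>t. t \<in> {0..1}) \<theta>"
proof -
  define a where "a = a\<^sub>1 - a\<^sub>0"
  define h where "h = h_cone k A a"
  have "0 < (norm a)\<^sup>2 - h"
    using h_cone_less[of k A a] assms(4,5) by (simp add: a_def h_def)
  \<comment> \<open>With \<open>F - a\<^sub>0\<close> split off, the squared norm contributes
    \<open>(norm a)\<^sup>2\<close> to the leading coefficient, and \<open>t * (1 - t) * h\<close>
    contributes \<open>- h\<close>.\<close>
  moreover have "(norm (F - ((1 - t) *\<^sub>R a\<^sub>0 + t *\<^sub>R a\<^sub>1)))\<^sup>2 + t * (1 - t) * h =
      ((norm a)\<^sup>2 - h) * t\<^sup>2 + (h - 2 * ((F - a\<^sub>0) \<bullet> a)) * t + (norm (F - a\<^sub>0))\<^sup>2" for t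
  proof -
    have "F - ((1 - t) *\<^sub>R a\<^sub>0 + t *\<^sub>R a\<^sub>1) = (F - a\<^sub>0) - t *\<^sub>R a"
      by (simp add: a_def algebra_simps)
    moreover have "(norm (x - t *\<^sub>R a))\<^sup>2 = (norm x)\<^sup>2 - 2 * t * (x \<bullet> a) + t\<^sup>2 * (norm a)\<^sup>2" for x
      unfolding power2_norm_eq_inner
      by (simp add: inner_diff inner_commute power2_eq_square)
    ultimately show ?thesis
      by (simp only:) (simp add: algebra_simps power2_eq_square)
  qed
  ultimately show ?thesis
    using ex1_is_arg_min_quadratic[of "(norm a)\<^sup>2 - h" 0 1]
    by (simp add: a_def h_def)
qed

end
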